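(* Let $R$ be a commutative ring with identity. The following are equivalent. (1) $R$ is Artinian. (2) The graph $GA_0(R)$ is connected.
   Context: Two ideals $I,J$ of $R$ are adjacent if one of them is strictly contained in the other and there is no ideal strictly between them. $GA_0(R)$ is the simple graph whose vertices are the proper ideals of $R$, with an edge between two distinct proper ideals $I$ and $J$ if and only if $I$ and $J$ are adjacent ideals. *)

theory Defs
  imports "HOL-Algebra.Ideal" "Graph_Theory.Digraph_Component"
begin

text \<open>
  For commutative rings the left, right and two-sided ideals coincide, so Artinian means the
  descending chain condition on ideals. The zero ring is not excluded.
\<close>
locale artinian_cring = cring R for R (structure) +
  assumes descending_chain_stationary:
    "\<lbrakk> \<And>n :: nat. ideal (I n) R; \<And>n. I (Suc n) \<subseteq> I n \<rbrakk> \<Longrightarrow> \<exists>N. \<forall>n\<ge>N. I n = I N"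

definition no_ideal_between :: "('a, 'b) ring_scheme \<Rightarrow> 'a set \<Rightarrow> 'a set \<Rightarrow> bool" where
  "no_ideal_between R I J \<longleftrightarrow> \<not> (\<exists>K. ideal K R \<and> I \<subset> K \<and> K \<subset> J)"

definition adjacent_ideals :: "('a, 'b) ring_scheme \<Rightarrow> 'a set \<Rightarrow> 'a set \<Rightarrow> bool" where
  "adjacent_ideals R I J \<longleftrightarrow> ideal I R \<and> ideal J R \<and>
     (I \<subset> J \<and> no_ideal_between R I J \<or> J \<subset> I \<and> no_ideal_between R J I)"

definition proper_ideals :: "('a, 'b) ring_scheme \<Rightarrow> 'a set set" where
  "proper_ideals R = {I. ideal I R \<and> I \<noteq> carrier R}"

text \<open>
  An undirected edge is encoded as a pair of opposite arcs. In contrast to the locale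
  \<^locale>\<open>pair_graph\<close>, the graph may be infinite.
\<close>
definition GA0 :: "('a, 'b) ring_scheme \<Rightarrow> 'a set pair_pre_digraph" where
  "GA0 R = \<lparr> pverts = proper_ideals R,
             parcs = {(I, J). I \<in> proper_ideals R \<and> J \<in> proper_ideals R \<and> I \<noteq> J
                              \<and> adjacent_ideals R I J} \<rparr>"

lemma pair_bidirected_digraph_GA0: "pair_bidirected_digraph (GA0 R)"
  by unfold_locales (auto simp: GA0_def adjacent_ideals_def symmetric_def intro!: symI)

text \<open>
  \<^const>\<open>Digraph_Component.connected\<close> is false for the graph without vertices. Here a graph is
  connected iff any two vertices are joined by a path, which holds vacuously for the graph without
  vertices; this only matters for the zero ring, which is Artinian and has no proper ideals.
\<close>
definition graph_connected :: "'a pair_pre_digraph \<Rightarrow> bool" where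
  "graph_connected G \<longleftrightarrow> pverts G = {} \<or> Digraph_Component.connected (with_proj G)"

lemma graph_connected_GA0_iff:
  "graph_connected (GA0 R) \<longleftrightarrow>
     (\<forall>I \<in> proper_ideals R. \<forall>J \<in> proper_ideals R. I \<rightarrow>\<^sup>*\<^bsub>with_proj (GA0 R)\<^esub> J)"
proof -
  have "mk_symmetric (with_proj (GA0 R)) = GA0 R"
    by (auto simp: mk_symmetric_def GA0_def adjacent_ideals_def)
  then show ?thesis
    by (auto simp: graph_connected_def Digraph_Component.connected_def strongly_connected_def
        GA0_def)
qed

end

theory Submission
  imports Defs "HOL-Algebra.Ring_Divisibility"
begin

text \<open>
  Write \<open>D \<lessdot> P\<close> when \<open>D \<subset> P\<close> are ideals with no ideal strictly between them.

  If the graph is connected, then every proper ideal is joined to the zero ideal by a path. The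
  descending chain condition on the ideals inside a given ideal is trivial for the zero ideal and
  survives each edge: going down is obvious, and going up along \<open>I \<lessdot> J\<close> a chain \<open>c\<close> inside \<open>J\<close> is
  controlled by \<open>c n \<inter> I\<close>, a chain inside \<open>I\<close>, and by \<open>c n + I\<close>, which can only be \<open>I\<close> or \<open>J\<close>; by
  the modular law, once both of these are constant, so is \<open>c n\<close> (\<open>dcc_below_cover\<close>). So the
  condition holds inside every proper ideal. A descending chain in \<open>R\<close> is either constantly \<open>R\<close> or
  eventually lies in a proper ideal, hence \<open>R\<close> is Artinian.

  Conversely, let \<open>R\<close> be Artinian. The key fact is that every nonzero ideal \<open>P\<close> has some
  \<open>D \<lessdot> P\<close> (\<open>nonzero_ideal_covers\<close>). Then one descends from any proper ideal along edges, and by the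
  chain condition this ends at the zero ideal; hence all vertices lie in one component.

  To find \<open>D\<close>, it is enough to find a maximal ideal \<open>M\<close> and an ideal \<open>K \<subset> P\<close> with \<open>M P \<subseteq> K\<close>: then \<open>P / K\<close> is a nonzero vector space over \<open>R / M\<close>, and
  \<open>D\<close> is the preimage of a hyperplane (\<open>covered_ideal_above\<close>). For this take \<open>I\<close> minimal
  among the ideals with \<open>I P \<noteq> 0\<close>, an \<open>a \<in> I\<close> with \<open>a P \<noteq> 0\<close>, a maximal ideal \<open>M\<close> containing the
  annihilator of \<open>a\<close>, and \<open>K = {x \<in> P. a x = 0}\<close>. If \<open>M P \<subseteq> K\<close> failed, then \<open>(a M) P \<noteq> 0\<close>, so
  \<open>a M = I\<close> by minimality and \<open>a = a y\<close> with \<open>y \<in> M\<close>; but then \<open>1 - y\<close> annihilates \<open>a\<close> and lies in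
  \<open>M\<close> too, which is absurd.
\<close>

section \<open>Ideals maximal subject to avoiding an element\<close>

lemma (in ring) exists_ideal_maximal_avoiding:
  assumes "ideal K R" "x \<notin> K"
  shows "\<exists>D. ideal D R \<and> K \<subseteq> D \<and> x \<notin> D \<and> (\<forall>E. ideal E R \<and> D \<subset> E \<longrightarrow> x \<in> E)"
proof -
  let ?A = "{D. ideal D R \<and> K \<subseteq> D \<and> x \<notin> D}"
  have "\<exists>D\<in>?A. \<forall>E\<in>?A. D \<subseteq> E \<longrightarrow> E = D"
  proof (rule subset_Zorn_nonempty)
    show "?A \<noteq> {}" using assms by auto
    fix C assume C: "C \<noteq> {}" "subset.chain ?A C"
    then have "subset.chain {I. ideal I R} C" and sub: "C \<subseteq> ?A"
      unfolding pred_on.chain_def by auto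
    then have "ideal (\<Union>C) R"
      using chain_Union_is_ideal[of C] C(1) by simp
    then show "\<Union>C \<in> ?A" using sub C(1) by auto
  qed
  then obtain D where D: "D \<in> ?A" and max: "\<forall>E\<in>?A. D \<subseteq> E \<longrightarrow> E = D"
    by (elim bexE)
  have "x \<in> E" if "ideal E R \<and> D \<subset> E" for E
    using bspec[OF max, of E] that D by auto
  then show ?thesis using D by blast
qed

text \<open>The sum \<open>D + (y)\<close> strictly contains \<open>D\<close>, so it contains \<open>x\<close>.\<close>
lemma (in cring) in_adjoin_ideal:
  assumes D: "ideal D R" and y: "y \<in> carrier R" "y \<notin> D"
    and max: "\<forall>E. ideal E R \<and> D \<subset> E \<longrightarrow> x \<in> E"
  obtains d r where "d \<in> D" "r \<in> carrier R" "x = d \<oplus> r \<otimes> y"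
proof -
  interpret D: ideal D R by (rule D)
  let ?E = "D <+>\<^bsub>R\<^esub> PIdl y"
  have P: "ideal (PIdl y) R" using cgenideal_ideal y by blast
  have "ideal ?E R" by (rule add_ideals[OF D P])
  moreover have "D \<subseteq> ?E"
  proof
    fix d assume "d \<in> D"
    then have "d = d \<oplus> \<zero>" by (simp add: D.Icarr)
    moreover have "\<zero> \<in> PIdl y" using P by (simp add: additive_subgroup.zero_closed ideal.axioms(1))
    ultimately show "d \<in> ?E" using \<open>d \<in> D\<close> unfolding set_add_def' by blast
  qed
  moreover have "y \<in> ?E"
  proof -
    have "y = \<zero> \<oplus> y" using y by simp
    then show ?thesis
      using cgenideal_self[OF y(1)] D.zero_closed unfolding set_add_def' by blast
  qed
  ultimately have "x \<in> ?E" using max y by blast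
  then show thesis using that unfolding set_add_def' cgenideal_def by blast
qed

lemma (in cring) exists_maximalideal_above:
  assumes "ideal K R" "K \<noteq> carrier R"
  obtains M where "maximalideal M R" "K \<subseteq> M"
proof -
  have "\<one> \<notin> K" using assms ideal.one_imp_carrier by blast
  then obtain M where M: "ideal M R" "K \<subseteq> M" "\<one> \<notin> M"
    and max: "\<forall>E. ideal E R \<and> M \<subset> E \<longrightarrow> \<one> \<in> E"
    using exists_ideal_maximal_avoiding[OF assms(1)] by blast
  have "maximalideal M R"
  proof (rule maximalidealI)
    show "carrier R \<noteq> M" using M(3) by blast
    fix J assume "ideal J R" "M \<subseteq> J" "J \<subseteq> carrier R"
    then show "J = M \<or> J = carrier R"
      using max ideal.one_imp_carrier by blast
  qed (rule M)
  then show thesis using that M by blast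
qed

section \<open>Nonzero ideals of an Artinian ring cover some ideal\<close>

text \<open>
  The quotient \<open>P / K\<close> is a vector space over \<open>R / M\<close>. For \<open>x \<in> P\<close> outside \<open>K\<close>, an ideal between \<open>K\<close>
  and \<open>P\<close> that is maximal among those avoiding \<open>x\<close> corresponds to a complement of the line through
  \<open>x\<close>, that is, to a hyperplane.
\<close>
lemma (in cring) covered_ideal_above:
  assumes "maximalideal M R" and K: "ideal K R" and P: "ideal P R" and "K \<subset> P"
    and MP: "\<And>r z. \<lbrakk>r \<in> M; z \<in> P\<rbrakk> \<Longrightarrow> r \<otimes> z \<in> K"
  obtains D where "ideal D R" "K \<subseteq> D" "D \<subset> P" "no_ideal_between R D P"
proof -
  interpret M: maximalideal M R by fact
  interpret P: ideal P R by fact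
  obtain x where x: "x \<in> P" "x \<notin> K" using \<open>K \<subset> P\<close> by blast
  obtain D where D: "ideal D R" "K \<subseteq> D" "x \<notin> D"
    and max: "\<forall>E. ideal E R \<and> D \<subset> E \<longrightarrow> x \<in> E"
    using exists_ideal_maximal_avoiding[OF K x(2)] by blast
  interpret D: ideal D R by (rule D)
  have I: "ideal (D \<inter> P) R" using i_intersect D(1) P by blast
  have "no_ideal_between R (D \<inter> P) P"
    unfolding no_ideal_between_def
  proof (intro notI, elim exE conjE)
    fix L assume L: "ideal L R" "D \<inter> P \<subset> L" "L \<subset> P"
    interpret L: ideal L R by (rule L)
    \<comment> \<open>Maximality of \<open>D\<close> is stated for ideals above \<open>D\<close>, not above \<open>D \<inter> P\<close>. The transfer works because
       \<open>x\<close> and \<open>L\<close> both lie in \<open>P\<close>, which forces the \<open>D\<close>-component of \<open>x\<close> into \<open>P\<close>.\<close>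
    have "x \<in> L"
    proof -
      obtain y where y: "y \<in> L" "y \<notin> D" using L by blast
      have yc: "y \<in> carrier R" using y L.Icarr by blast
      obtain d r where dr: "d \<in> D" "r \<in> carrier R" "x = d \<oplus> r \<otimes> y"
        using D(1) yc y(2) max by (rule in_adjoin_ideal)
      have ry: "r \<otimes> y \<in> L" using dr y L.I_l_closed by blast
      have "d = x \<ominus> r \<otimes> y" using dr yc D.Icarr[OF dr(1)] by algebra
      moreover have "x \<ominus> r \<otimes> y \<in> P"
        using x ry L(3) by (auto simp: a_minus_def)
      ultimately have "d \<in> L" using dr L by blast
      then show ?thesis using dr ry by simp
    qed
    \<comment> \<open>The elements of \<open>D \<inter> P\<close> together with \<open>x\<close> generate \<open>P\<close>: in \<open>x = d + r z\<close> the coefficient \<open>r\<close>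
       can be inverted modulo \<open>M\<close>, which expresses \<open>z\<close> by \<open>x\<close>, \<open>d\<close> and an element of \<open>M P\<close>.\<close>
    have "z \<in> L" if z: "z \<in> P" for z
    proof (cases "z \<in> D")
      case True then show ?thesis using z L by blast
    next
      case False
      have zc: "z \<in> carrier R" using z P.Icarr by blast
      obtain d r where dr: "d \<in> D" "r \<in> carrier R" "x = d \<oplus> r \<otimes> z"
        using D(1) zc False max by (rule in_adjoin_ideal)
      have dc: "d \<in> carrier R" using dr D.Icarr by blast
      have "r \<notin> M"
      proof
        assume "r \<in> M"
        then have "r \<otimes> z \<in> D" using MP z D by blast
        then show False using dr D by simp
      qed
      \<comment> \<open>\<open>s\<close> is an inverse of \<open>r\<close> modulo \<open>M\<close>.\<close>
      have "\<one> \<in> E" if "ideal E R" "M \<subset> E" for E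
      proof -
        have "E \<subseteq> carrier R" using ideal.Icarr[OF that(1)] by blast
        then have "E = carrier R" using M.I_maximal[OF that(1)] that(2) by blast
        then show ?thesis by simp
      qed
      then have "\<forall>E. ideal E R \<and> M \<subset> E \<longrightarrow> \<one> \<in> E" by blast
      with M.ideal_axioms dr(2) \<open>r \<notin> M\<close>
      obtain m s where ms: "m \<in> M" "s \<in> carrier R" "\<one> = m \<oplus> s \<otimes> r"
        by (rule in_adjoin_ideal)
      have mc: "m \<in> carrier R" using ms M.Icarr by blast
      have "d = x \<ominus> r \<otimes> z" using dr zc dc by algebra
      moreover have "x \<ominus> r \<otimes> z \<in> P"
        using x z dr(2) P.I_l_closed by (auto simp: a_minus_def)
      ultimately have dL: "d \<in> L" using dr L by blast
      have mz: "m \<otimes> z \<in> L" using MP[OF ms(1) z] L \<open>K \<subset> P\<close> D(2) by blast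
      have "z = (m \<oplus> s \<otimes> r) \<otimes> z" using zc by (simp flip: ms(3))
      also have "\<dots> = m \<otimes> z \<oplus> s \<otimes> ((d \<oplus> r \<otimes> z) \<ominus> d)"
        using mc ms(2) dr(2) zc dc by algebra
      finally have "z = m \<otimes> z \<oplus> s \<otimes> (x \<ominus> d)" using dr by simp
      moreover have "s \<otimes> (x \<ominus> d) \<in> L"
        using \<open>x \<in> L\<close> dL ms by (auto simp: a_minus_def intro!: L.I_l_closed)
      then have "m \<otimes> z \<oplus> s \<otimes> (x \<ominus> d) \<in> L" by (rule L.a_closed[OF mz])
      ultimately show ?thesis by (rule ssubst)
    qed
    then show False using L by blast
  qed
  then show thesis using that[OF I] x D \<open>K \<subset> P\<close> by blast
qed

lemma (in artinian_cring) exists_minimal_ideal: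
  assumes "\<And>I. I \<in> S \<Longrightarrow> ideal I R" "S \<noteq> {}"
  shows "\<exists>I\<in>S. \<forall>J\<in>S. J \<subseteq> I \<longrightarrow> J = I"
proof (rule ccontr)
  assume "\<not> ?thesis"
  then have "\<forall>I\<in>S. \<exists>J\<in>S. J \<subset> I" by blast
  then obtain f where f: "\<And>I. I \<in> S \<Longrightarrow> f I \<in> S \<and> f I \<subset> I" by metis
  obtain I0 where "I0 \<in> S" using assms by blast
  define c where "c n = (f ^^ n) I0" for n
  have S: "c n \<in> S" for n by (induction n) (use \<open>I0 \<in> S\<close> f in \<open>auto simp: c_def\<close>)
  have dec: "c (Suc n) \<subset> c n" for n using f[OF S[of n]] by (simp add: c_def)
  obtain N where "\<forall>n\<ge>N. c n = c N"
    using descending_chain_stationary[of c] assms(1) S dec by (metis psubset_imp_subset)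
  then show False using dec[of N] by (metis le_SucI order_refl psubset_eq)
qed

lemma (in cring) ideal_annihilated_in:
  assumes "ideal P R" "a \<in> carrier R"
  shows "ideal {x \<in> P. a \<otimes> x = \<zero>} R"
proof -
  interpret P: ideal P R by fact
  show ?thesis
  proof (rule idealI)
    show "ring R" by (rule ring_axioms)
    show "subgroup {x \<in> P. a \<otimes> x = \<zero>} (add_monoid R)"
      using assms P.Icarr by (intro add.subgroupI) (auto simp: r_distr r_minus intro: exI[of _ \<zero>])
  next
    fix x r assume "x \<in> {x \<in> P. a \<otimes> x = \<zero>}" "r \<in> carrier R"
    moreover from this have "x \<in> carrier R" using P.Icarr by blast
    ultimately show "r \<otimes> x \<in> {x \<in> P. a \<otimes> x = \<zero>}" "x \<otimes> r \<in> {x \<in> P. a \<otimes> x = \<zero>}"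
      using assms P.I_l_closed P.I_r_closed
      by (auto simp: m_lcomm[of a r x] m_comm[of x r])
  qed
qed

lemma (in cring) ideal_multiples:
  assumes "ideal M R" "a \<in> carrier R"
  shows "ideal ((\<otimes>) a ` M) R"
proof -
  interpret M: ideal M R by fact
  show ?thesis
  proof (rule idealI)
    show "ring R" by (rule ring_axioms)
    have "M \<noteq> {}" using M.zero_closed by blast
    then show "subgroup ((\<otimes>) a ` M) (add_monoid R)"
      using assms M.Icarr
      by (intro add.subgroupI)
        (auto simp: r_distr[symmetric] r_minus[symmetric] intro!: imageI M.a_closed M.a_inv_closed)
  next
    fix x r assume "x \<in> (\<otimes>) a ` M" and r: "r \<in> carrier R"
    then obtain y where y: "y \<in> M" "x = a \<otimes> y" by blast
    then have "r \<otimes> x = a \<otimes> (r \<otimes> y)" "x \<otimes> r = a \<otimes> (y \<otimes> r)"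
      using r assms M.Icarr by (auto simp: m_lcomm m_assoc)
    then show "r \<otimes> x \<in> (\<otimes>) a ` M" "x \<otimes> r \<in> (\<otimes>) a ` M"
      using r y M.I_l_closed M.I_r_closed by auto
  qed
qed

text \<open>
  Since \<open>P\<close> may fail to be finitely generated, Nakayama's lemma does not give \<open>M P \<subset> P\<close>. The Nakayama
  argument is applied instead to the element \<open>a\<close> of an ideal \<open>I\<close> that is minimal among those not
  annihilating \<open>P\<close>, where minimality replaces finite generation.
\<close>
lemma (in artinian_cring) nonzero_ideal_covers:
  assumes P: "ideal P R" "P \<noteq> {\<zero>}"
  obtains D where "ideal D R" "D \<subset> P" "no_ideal_between R D P"
proof -
  interpret P: ideal P R by fact
  let ?S = "{I. ideal I R \<and> (\<exists>a\<in>I. \<exists>p\<in>P. a \<otimes> p \<noteq> \<zero>)}"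
  obtain p where "p \<in> P" "p \<noteq> \<zero>" using P P.zero_closed by blast
  then have "\<one> \<otimes> p \<noteq> \<zero>" using P.Icarr by simp
  then have "carrier R \<in> ?S" using oneideal \<open>p \<in> P\<close> one_closed by blast
  then have "\<exists>I\<in>?S. \<forall>J\<in>?S. J \<subseteq> I \<longrightarrow> J = I"
    by (intro exists_minimal_ideal) auto
  then obtain I where I: "I \<in> ?S" and min: "\<forall>J\<in>?S. J \<subseteq> I \<longrightarrow> J = I"
    by (elim bexE)
  obtain a q where a: "a \<in> I" "q \<in> P" "a \<otimes> q \<noteq> \<zero>" using I by blast
  interpret I: ideal I R using I by blast
  have ac: "a \<in> carrier R" using a I.Icarr by blast
  let ?Ann = "{x \<in> carrier R. a \<otimes> x = \<zero>}"
  have "ideal ?Ann R" by (rule ideal_annihilated_in[OF oneideal ac])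
  moreover have "?Ann \<noteq> carrier R" using a(2,3) P.Icarr by blast
  ultimately obtain M where M: "maximalideal M R" "?Ann \<subseteq> M"
    by (rule exists_maximalideal_above)
  interpret M: maximalideal M R by (rule M)
  let ?K = "{x \<in> P. a \<otimes> x = \<zero>}"
  have "r \<otimes> z \<in> ?K" if r: "r \<in> M" and z: "z \<in> P" for r z
  proof (rule ccontr)
    assume "\<not> ?thesis"
    then have "a \<otimes> (r \<otimes> z) \<noteq> \<zero>" using r z P.I_l_closed M.Icarr by blast
    then have "a \<otimes> r \<otimes> z \<noteq> \<zero>" using r z ac P.Icarr M.Icarr by (simp add: m_assoc)
    then have "(\<otimes>) a ` M \<in> ?S"
      using ideal_multiples[OF M.ideal_axioms ac] r z by blast
    moreover have "(\<otimes>) a ` M \<subseteq> I" using a I.I_r_closed M.Icarr by blast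
    ultimately have "(\<otimes>) a ` M = I" using min by blast
    then obtain y where y: "y \<in> M" "a = a \<otimes> y" using a by blast
    have yc: "y \<in> carrier R" using y M.Icarr by blast
    have "a \<otimes> (\<one> \<ominus> y) = a \<ominus> a \<otimes> y" using ac yc by algebra
    also have "\<dots> = \<zero>" using y(2) ac by (metis r_right_minus_eq)
    finally have "\<one> \<ominus> y \<in> M" using M yc by auto
    then have "(\<one> \<ominus> y) \<oplus> y \<in> M" using y by blast
    moreover have "(\<one> \<ominus> y) \<oplus> y = \<one>" using yc by algebra
    ultimately show False using M.one_imp_carrier M.I_notcarr by simp
  qed
  moreover have "?K \<subset> P" using a by blast
  ultimately show thesis
    using covered_ideal_above[OF M(1) ideal_annihilated_in[OF P(1) ac] P(1)] that by metis
qed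

section \<open>Artinian rings have a connected graph\<close>

lemma GA0_arcI:
  assumes "ideal D R" "ideal P R" "P \<noteq> carrier R" "D \<subset> P" "no_ideal_between R D P"
  shows "P \<rightarrow>\<^bsub>with_proj (GA0 R)\<^esub> D"
proof -
  have "D \<noteq> carrier R" using assms(4) ideal.Icarr[OF assms(2)] by blast
  then show ?thesis
    using assms by (auto simp: GA0_def adjacent_ideals_def proper_ideals_def)
qed

text \<open>
  A minimal counterexample is nonzero, so it covers a smaller ideal, from which the zero ideal can be
  reached.
\<close>
lemma (in artinian_cring) zero_reachable:
  assumes "P \<in> proper_ideals R"
  shows "P \<rightarrow>\<^sup>*\<^bsub>with_proj (GA0 R)\<^esub> {\<zero>}"
proof (rule ccontr)
  interpret G: pair_bidirected_digraph "GA0 R" by (rule pair_bidirected_digraph_GA0)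
  let ?S = "{I \<in> proper_ideals R. \<not> I \<rightarrow>\<^sup>*\<^bsub>with_proj (GA0 R)\<^esub> {\<zero>}}"
  assume "\<not> ?thesis"
  then have "P \<in> ?S" using assms by blast
  then have "\<exists>I\<in>?S. \<forall>J\<in>?S. J \<subseteq> I \<longrightarrow> J = I"
    by (intro exists_minimal_ideal) (auto simp: proper_ideals_def)
  then obtain I where I: "I \<in> ?S" and min: "\<forall>J\<in>?S. J \<subseteq> I \<longrightarrow> J = I"
    by (elim bexE)
  have "pverts (GA0 R) = proper_ideals R" by (simp add: GA0_def)
  then have "I \<noteq> {\<zero>}" using I G.reachable_refl[of "{\<zero>}"] by auto
  then obtain D where D: "ideal D R" "D \<subset> I" "no_ideal_between R D I"
    using I nonzero_ideal_covers[of I] by (auto simp: proper_ideals_def)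
  have arc: "I \<rightarrow>\<^bsub>with_proj (GA0 R)\<^esub> D"
    using GA0_arcI D I by (auto simp: proper_ideals_def)
  then have "D \<in> proper_ideals R" by (auto simp: GA0_def)
  then have "D \<rightarrow>\<^sup>*\<^bsub>with_proj (GA0 R)\<^esub> {\<zero>}" using min D by blast
  with arc have "I \<rightarrow>\<^sup>*\<^bsub>with_proj (GA0 R)\<^esub> {\<zero>}"
    by (auto intro: G.adj_reachable_trans)
  then show False using I by blast
qed

lemma (in artinian_cring) graph_connected_GA0: "graph_connected (GA0 R)"
  unfolding graph_connected_GA0_iff
proof (intro ballI)
  interpret G: pair_bidirected_digraph "GA0 R" by (rule pair_bidirected_digraph_GA0)
  have "symmetric (with_proj (GA0 R))"
    using G.sym_arcs by simp
  fix I J assume "I \<in> proper_ideals R" "J \<in> proper_ideals R"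
  then have "I \<rightarrow>\<^sup>*\<^bsub>with_proj (GA0 R)\<^esub> {\<zero>}" "{\<zero>} \<rightarrow>\<^sup>*\<^bsub>with_proj (GA0 R)\<^esub> J"
    using zero_reachable symmetric_reachable[OF \<open>symmetric _\<close>] by blast+
  then show "I \<rightarrow>\<^sup>*\<^bsub>with_proj (GA0 R)\<^esub> J" by (rule G.reachable_trans)
qed

section \<open>A connected graph forces the descending chain condition\<close>

definition dcc_below :: "('a, 'b) ring_scheme \<Rightarrow> 'a set \<Rightarrow> bool" where
  "dcc_below R I \<longleftrightarrow> (\<forall>c :: nat \<Rightarrow> 'a set.
     (\<forall>n. ideal (c n) R \<and> c n \<subseteq> I) \<and> (\<forall>n. c (Suc n) \<subseteq> c n) \<longrightarrow> (\<exists>N. \<forall>n\<ge>N. c n = c N))"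

lemma dcc_below_mono: "dcc_below R J \<Longrightarrow> I \<subseteq> J \<Longrightarrow> dcc_below R I"
  unfolding dcc_below_def by (meson order_trans)

lemma dcc_belowD:
  assumes "dcc_below R I" "\<And>n. ideal (c n) R" "\<And>n. c n \<subseteq> I" "\<And>n. c (Suc n) \<subseteq> c n"
  shows "\<exists>N. \<forall>n\<ge>N. c n = c N"
  using assms unfolding dcc_below_def by blast

text \<open>
  The modular law gives \<open>B = B \<inter> (A + I) = A + (B \<inter> I) = A\<close>.
\<close>
lemma (in ring) ideal_eq_by_modularity:
  assumes "ideal A R" "ideal B R" "ideal I R" "A \<subseteq> B"
    and inter: "B \<inter> I \<subseteq> A" and sum: "B \<subseteq> A <+>\<^bsub>R\<^esub> I"
  shows "A = B"
proof
  interpret A: ideal A R by fact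
  interpret B: ideal B R by fact
  interpret I: ideal I R by fact
  show "B \<subseteq> A"
  proof
    fix b assume b: "b \<in> B"
    then obtain a i where ai: "a \<in> A" "i \<in> I" "b = a \<oplus> i"
      using sum unfolding set_add_def' by blast
    then have "i = \<ominus> a \<oplus> b"
      using A.Icarr I.Icarr by (simp add: r_neg2 r_neg1)
    moreover have "\<ominus> a \<oplus> b \<in> B" using ai b \<open>A \<subseteq> B\<close> by blast
    ultimately have "i \<in> A" using inter ai by blast
    then show "b \<in> A" using ai by simp
  qed
qed fact

lemma (in ring) dcc_below_cover:
  assumes I: "ideal I R" and J: "ideal J R" and "I \<subset> J" and cov: "no_ideal_between R I J"
    and dcc: "dcc_below R I"
  shows "dcc_below R J"
  unfolding dcc_below_def
proof (intro allI impI, elim conjE)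
  fix c :: "nat \<Rightarrow> 'a set"
  assume c: "\<forall>n. ideal (c n) R \<and> c n \<subseteq> J" and step: "\<forall>n. c (Suc n) \<subseteq> c n"
  interpret I: ideal I R by fact
  interpret J: ideal J R by fact
  have anti: "c n \<subseteq> c m" if "m \<le> n" for m n
    using lift_Suc_antimono_le[of c] step that by blast
  have "\<exists>N. \<forall>n\<ge>N. c n \<inter> I = c N \<inter> I"
    using c step I by (intro dcc_belowD[OF dcc]) (auto intro: i_intersect)
  then obtain N where N: "\<And>n. n \<ge> N \<Longrightarrow> c n \<inter> I = c N \<inter> I" by blast
  \<comment> \<open>The sums \<open>c n + I\<close> take only the values \<open>I\<close> and \<open>J\<close>, so they are constant once some \<open>c n\<close>
     lies in \<open>I\<close>, and constant throughout if none does.\<close>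
  show "\<exists>N. \<forall>n\<ge>N. c n = c N"
  proof (cases "\<exists>m. c m \<subseteq> I")
    case True
    then obtain m where m: "c m \<subseteq> I" by blast
    have "c n = c (max m N)" if "n \<ge> max m N" for n
    proof -
      have "c n \<subseteq> I" "c (max m N) \<subseteq> I"
        using m anti[of m n] anti[of m "max m N"] that by auto
      then show ?thesis using N[of n] N[of "max m N"] that by auto
    qed
    then show ?thesis by blast
  next
    case False
    have sum: "c n <+>\<^bsub>R\<^esub> I = J" for n
    proof -
      have cn: "ideal (c n) R" "c n \<subseteq> J" using c by auto
      interpret C: ideal "c n" R by (rule cn)
      have S: "ideal (c n <+>\<^bsub>R\<^esub> I) R" by (rule add_ideals[OF cn(1) I])
      have IS: "I \<subseteq> c n <+>\<^bsub>R\<^esub> I"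
      proof
        fix i assume "i \<in> I"
        then have "i = \<zero> \<oplus> i" using I.Icarr by simp
        then show "i \<in> c n <+>\<^bsub>R\<^esub> I"
          using \<open>i \<in> I\<close> C.zero_closed unfolding set_add_def' by blast
      qed
      have cS: "c n \<subseteq> c n <+>\<^bsub>R\<^esub> I"
      proof
        fix i assume "i \<in> c n"
        then have "i = i \<oplus> \<zero>" using C.Icarr by simp
        then show "i \<in> c n <+>\<^bsub>R\<^esub> I"
          using \<open>i \<in> c n\<close> I.zero_closed unfolding set_add_def' by blast
      qed
      have "c n <+>\<^bsub>R\<^esub> I \<subseteq> J"
        using cn \<open>I \<subset> J\<close> unfolding set_add_def' by blast
      moreover have "I \<subset> c n <+>\<^bsub>R\<^esub> I" using False IS cS by blast
      ultimately show ?thesis using cov S unfolding no_ideal_between_def by blast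
    qed
    have "c n = c N" if "n \<ge> N" for n
    proof (rule ideal_eq_by_modularity[where I = I])
      show "c n \<subseteq> c N" using anti that by blast
      show "c N \<inter> I \<subseteq> c n" using N[OF that] by blast
    qed (use c I sum in auto)
    then show ?thesis by blast
  qed
qed

lemma (in ring) dcc_below_zero: "dcc_below R {\<zero>}"
proof -
  have "I = {\<zero>}" if "ideal I R" "I \<subseteq> {\<zero>}" for I
    using that additive_subgroup.zero_closed[OF ideal.axioms(1)] by blast
  then show ?thesis unfolding dcc_below_def by metis
qed

lemma (in ring) dcc_below_reachable:
  assumes "{\<zero>} \<rightarrow>\<^sup>*\<^bsub>with_proj (GA0 R)\<^esub> I"
  shows "dcc_below R I"
proof -
  interpret G: pair_bidirected_digraph "GA0 R" by (rule pair_bidirected_digraph_GA0)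
  show ?thesis
    using assms
  proof (induction rule: G.reachable_induct)
    case base
    show ?case by (rule dcc_below_zero)
  next
    case (step I J)
    then have "adjacent_ideals R I J" by (auto simp: GA0_def)
    then show ?case
      using step.IH dcc_below_cover[of I J] dcc_below_mono[of R I J]
      unfolding adjacent_ideals_def by blast
  qed
qed

lemma (in cring) artinian_if_graph_connected:
  assumes "graph_connected (GA0 R)"
  shows "artinian_cring R"
proof unfold_locales
  fix c :: "nat \<Rightarrow> 'a set"
  assume ideals: "\<And>n. ideal (c n) R" and step: "\<And>n. c (Suc n) \<subseteq> c n"
  show "\<exists>N. \<forall>n\<ge>N. c n = c N"
  proof (cases "\<exists>m. c m \<in> proper_ideals R")
    case False
    then show ?thesis using ideals by (auto simp: proper_ideals_def)
  next
    case True
    then obtain m where m: "c m \<in> proper_ideals R" by blast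
    have anti: "c n \<subseteq> c k" if "k \<le> n" for k n
      using lift_Suc_antimono_le[of c, OF step that] .
    have "\<one> \<notin> c m"
      using m ideal.one_imp_carrier[OF ideals] by (auto simp: proper_ideals_def)
    moreover have "\<zero> \<in> c m" using additive_subgroup.zero_closed[OF ideal.axioms(1)[OF ideals]] .
    ultimately have "{\<zero>} \<noteq> carrier R" using one_closed by (metis singletonD)
    then have "{\<zero>} \<in> proper_ideals R" using zeroideal by (simp add: proper_ideals_def)
    then have "{\<zero>} \<rightarrow>\<^sup>*\<^bsub>with_proj (GA0 R)\<^esub> c m"
      using assms m unfolding graph_connected_GA0_iff by blast
    then have "dcc_below R (c m)" by (rule dcc_below_reachable)
    then have "\<exists>N. \<forall>n\<ge>N. c (m + n) = c (m + N)"
      using ideals anti step by (intro dcc_belowD[of R "c m"]) auto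
    then obtain N where N: "\<And>n. n \<ge> N \<Longrightarrow> c (m + n) = c (m + N)" by blast
    have "c n = c (m + N)" if "n \<ge> m + N" for n
      using N[of "n - m"] that by simp
    then show ?thesis by blast
  qed
qed

theorem theorem3p13:
  fixes R :: "('a, 'b) ring_scheme"
  assumes "cring R"
  shows "artinian_cring R \<longleftrightarrow> graph_connected (GA0 R)"
  using artinian_cring.graph_connected_GA0 cring.artinian_if_graph_connected[OF assms] by blast

end
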